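(* Let $p\geq 3$ be prime and let $g\in\mathrm{SL}_2(\mathbf{F}_p)$ be a regular semisimple element with non-zero trace. Let $\mathrm{Cl}(g)\subset\mathrm{SL}_2(\overline{\mathbf{F}}_p)$ be the conjugacy class of $g$ in $\mathrm{SL}_2(\overline{\mathbf{F}}_p)$. If $H\subset\mathrm{SL}_2(\mathbf{F}_p)$ is a symmetric generating set of $\mathrm{SL}_2(\mathbf{F}_p)$ containing $1$, and $\alpha=|H\cdot H\cdot H|/|H|$, then $$|\mathrm{Cl}(g)\cap H|\leq 7\alpha^{2/3}|H|^{2/3}$$ unless $\alpha>|H|^{1/28}$.
   Context: An element of $\mathrm{SL}_2(\overline{\mathbf{F}}_p)$ is regular semisimple if it is semisimple with distinct eigenvalues (for $p\ne 2$ this means its trace $t$ satisfies $t^2\neq 4$). *)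

theory Defs
  imports
    "HOL-Analysis.Analysis"
    "HOL-Algebra.Coset"
    "HOL-Algebra.Generated_Groups"
    "HOL-Algebra.Algebraic_Closure_Type"
    "Berlekamp_Zassenhaus.Finite_Field"
begin

hide_const (open) Divisibility.prime

definition SL2 :: "('k::field ^ 2 ^ 2) monoid" where
  "SL2 = \<lparr>carrier = {A. det A = 1}, monoid.mult = (**), one = mat 1\<rparr>"

lemma group_SL2: "group (SL2 :: ('k::field ^ 2 ^ 2) monoid)"
proof (rule groupI)
  fix A :: "'k ^ 2 ^ 2"
  assume "A \<in> carrier SL2"
  then have d: "det A = 1" by (simp add: SL2_def)
  then obtain B where B: "A ** B = mat 1" "B ** A = mat 1"
    using invertible_det_nz[of A] unfolding invertible_def by auto
  have "det B = 1" using B(1) d by (metis det_I det_mul mult_1)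
  with B show "\<exists>B\<in>carrier SL2. B \<otimes>\<^bsub>SL2\<^esub> A = \<one>\<^bsub>SL2\<^esub>"
    by (auto simp: SL2_def)
qed (auto simp: SL2_def det_mul matrix_mul_assoc)

definition conj_class :: "('a, 'b) monoid_scheme \<Rightarrow> 'a \<Rightarrow> 'a set" where
  "conj_class G g = {x \<otimes>\<^bsub>G\<^esub> g \<otimes>\<^bsub>G\<^esub> inv\<^bsub>G\<^esub> x | x. x \<in> carrier G}"

definition eigval :: "'k::field ^ 'n ^ 'n \<Rightarrow> 'k \<Rightarrow> bool" where
  "eigval A c \<longleftrightarrow> (\<exists>v. v \<noteq> 0 \<and> A *v v = c *s v)"

text \<open>Over an algebraically closed field, semisimple means diagonalizable.\<close>

definition semisimple_matrix :: "'k::alg_closed_field ^ 'n ^ 'n \<Rightarrow> bool" where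
  "semisimple_matrix A \<longleftrightarrow>
     (\<exists>P D :: 'k ^ 'n ^ 'n. invertible P \<and> (\<forall>i j. i \<noteq> j \<longrightarrow> D $ i $ j = 0) \<and> A = P ** D ** matrix_inv P)"

text \<open>An \<open>n \<times> n\<close> matrix has distinct eigenvalues if it has \<open>n\<close> of them.\<close>

definition regular_semisimple :: "'k::alg_closed_field ^ 'n ^ 'n \<Rightarrow> bool" where
  "regular_semisimple A \<longleftrightarrow> semisimple_matrix A \<and> card {c. eigval A c} = CARD('n)"

text \<open>The inclusion of matrices over a field into matrices over its algebraic closure.\<close>

abbreviation to_ac_mat :: "'k::field ^ 'n ^ 'm \<Rightarrow> 'k alg_closure ^ 'n ^ 'm" where
  "to_ac_mat \<equiv> map_matrix to_ac"

end

theory Submission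
  imports Defs
begin

text \<open>
  Let \<open>A\<close> be the set of elements of \<open>H\<close> conjugate to \<open>g\<close>, \<open>t \<noteq> 0\<close> their common trace and
  \<open>T = |H H H| = \<alpha> |H|\<close>. The map \<open>(x, y, z) \<mapsto> (x y, x z)\<close> sends \<open>A \<times> A \<times> A\<close> into a set of at most
  \<open>T\<^sup>2\<close> elements. Over the image of \<open>(x, y, z)\<close>, writing a point of the fibre as \<open>(x q\<inverse>, q y, q z)\<close>, one has
  three affine equations \<open>tr (q x\<inverse>) = tr (q y) = tr (q z) = t\<close>. If \<open>x\<inverse>\<close>, \<open>y\<close>, \<open>z\<close> are distinct,
  these cut the quadric \<open>det q = 1\<close> in at most two points unless the solution line lies on the quadric
  or \<open>x\<inverse>\<close>, \<open>y\<close>, \<open>z\<close> are collinear on one of its rulings (here \<open>t \<noteq> 0\<close> is used); in both cases a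
  nilpotent direction yields a common eigenvector of \<open>x\<close>, \<open>y\<close>, \<open>z\<close>.

  Elements of \<open>H\<close> with a prescribed eigenvector \<open>v\<close> and eigenvalue are few: if \<open>h \<in> H\<close> moves the line
  of \<open>v\<close>, then \<open>(x, y) \<mapsto> x h y\<close> is injective on pairs of them, so there are at most \<open>T\<^sup>1\<^sup>/\<^sup>2\<close>. Hence
  \<open>|A|\<^sup>3 \<le> 3 |A|\<^sup>2 + 16 T |A| + 2 T\<^sup>2\<close>, which forces \<open>|A| \<le> 7 T\<^sup>2\<^sup>/\<^sup>3\<close>.
\<close>

no_notation fps_nth (infixl "$" 75)

section \<open>Linear algebra of two-by-two matrices\<close>

lemmas mat2_simps = matrix_matrix_mult_def matrix_vector_mult_def trace_def det_2 sum_2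
  vec_eq_iff forall_2 mat_def

lemma parallel_vec2:
  fixes v w :: "'k::field ^ 2"
  assumes "v \<noteq> 0" "v $ 1 * w $ 2 = v $ 2 * w $ 1"
  obtains c where "w = c *s v"
proof (cases "v $ 1 = 0")
  case True
  with assms have "v $ 2 \<noteq> 0" "w $ 1 = 0" by (auto simp: vec_eq_iff forall_2)
  with True have "w = (w $ 2 / v $ 2) *s v" by (simp add: vec_eq_iff forall_2)
  then show ?thesis by (rule that)
next
  case False
  with assms have "w = (w $ 1 / v $ 1) *s v" by (simp add: vec_eq_iff forall_2 field_simps)
  then show ?thesis by (rule that)
qed

text \<open>The equations are the vanishing of all two-by-two minors. This serves both the collinear
  case and the direction of the solution line below.\<close>

lemma parallel_triple:
  fixes n1 n2 n3 x1 x2 x3 :: "'k::field"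
  assumes "n1 \<noteq> 0 \<or> n2 \<noteq> 0 \<or> n3 \<noteq> 0"
    and "n1 * x2 = n2 * x1" "n1 * x3 = n3 * x1" "n2 * x3 = n3 * x2"
  obtains s where "x1 = s * n1" "x2 = s * n2" "x3 = s * n3"
proof -
  consider "n1 \<noteq> 0" | "n2 \<noteq> 0" | "n3 \<noteq> 0" using assms(1) by blast
  then show ?thesis
  proof cases
    case 1 then show ?thesis using assms that[of "x1 / n1"] by (simp add: field_simps)
  next
    case 2 then show ?thesis using assms that[of "x2 / n2"] by (simp add: field_simps)
  next
    case 3 then show ?thesis using assms that[of "x3 / n3"] by (simp add: field_simps)
  qed
qed

text \<open>
  The method \<open>Groebner_Basis.algebra\<close>, shadowed by a method of HOL-Algebra, only treats variables as
  atoms; hence matrix entries are named.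
\<close>

lemma mat2_entries:
  fixes A :: "'k ^ 2 ^ 2"
  obtains p q r s where "A $ 1 $ 1 = p" "A $ 1 $ 2 = q" "A $ 2 $ 1 = r" "A $ 2 $ 2 = s"
  by blast

text \<open>Image and kernel of \<open>n\<close> are the same line, spanned by some
  \<open>v\<close>, so \<open>n = v w^T\<close> with \<open>w^T v = 0\<close>. Then
  \<open>trace (n ** a) = w^T (a v)\<close>, and its vanishing puts \<open>a v\<close> back on that
  line.\<close>

lemma nilpotent_kernel_eigenvector:
  fixes n :: "'k::field ^ 2 ^ 2"
  assumes "n \<noteq> 0" "trace n = 0" "det n = 0"
  obtains v where "v \<noteq> 0" "\<And>a. trace (n ** a) = 0 \<Longrightarrow> \<exists>c. a *v v = c *s v"
proof -
  obtain p q r p' where "n $ 1 $ 1 = p" "n $ 1 $ 2 = q" "n $ 2 $ 1 = r" "n $ 2 $ 2 = p'"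
    by (rule mat2_entries)
  moreover from this have "p' = - p" using assms(2) by (simp add: mat2_simps add_eq_0_iff)
  ultimately have n: "n $ 1 $ 1 = p" "n $ 1 $ 2 = q" "n $ 2 $ 1 = r" "n $ 2 $ 2 = - p" by auto
  have det: "p * p + q * r = 0" using assms(3) by (simp add: det_2 n add_eq_0_iff)
  \<comment> \<open>\<open>v\<close> spans the kernel of \<open>n\<close>. If \<open>q = 0\<close>,
    the determinant forces \<open>p = 0\<close>, and the second formula would give the zero
    vector.\<close>
  define v :: "'k ^ 2" where "v = (if q = 0 then vector [0, 1] else vector [q, - p])"
  have v0: "v \<noteq> 0" by (auto simp: v_def vec_eq_iff forall_2)
  have "\<exists>c. a *v v = c *s v" if a: "trace (n ** a) = 0" for a
  proof -
    obtain a1 a2 a3 a4 where a_eq: "a $ 1 $ 1 = a1" "a $ 1 $ 2 = a2" "a $ 2 $ 1 = a3" "a $ 2 $ 2 = a4"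
      by (rule mat2_entries)
    have tr: "p * a1 + q * a3 + r * a2 - p * a4 = 0"
      using a by (simp add: mat2_simps n a_eq algebra_simps)
    have "v $ 1 * (a *v v) $ 2 = v $ 2 * (a *v v) $ 1"
    proof (cases "q = 0")
      case True
      with det have "p = 0" by simp
      with True n assms(1) have "r \<noteq> 0" by (auto simp: vec_eq_iff forall_2)
      with tr True \<open>p = 0\<close> have "a2 = 0" by simp
      then show ?thesis using True by (simp add: v_def mat2_simps a_eq)
    next
      case False
      from det tr have "q * (a3 * q - a4 * p) = - p * (a1 * q - a2 * p)"
        by Groebner_Basis.algebra
      then show ?thesis using False by (simp add: v_def mat2_simps a_eq)
    qed
    then show ?thesis using parallel_vec2[OF v0] by metis
  qed
  with v0 show ?thesis by (rule that)
qed

section \<open>Degenerate trace equations and common eigenvectors\<close>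

definition common_eigvec :: "('k::field ^ 'n ^ 'n) set \<Rightarrow> bool" where
  "common_eigvec S \<longleftrightarrow> (\<exists>v. v \<noteq> 0 \<and> (\<forall>x\<in>S. \<exists>c. x *v v = c *s v))"

text \<open>With \<open>d = b - a\<close>, the polynomial \<open>det (a + X d) - 1\<close> has
  degree at most two and the distinct roots 0, 1 and \<open>s\<close>, so it vanishes identically.
  Hence \<open>d\<close> is nilpotent and orthogonal to \<open>a\<close> under the trace
  pairing.\<close>

lemma collinear_common_eigenvector:
  fixes a b c :: "'k::field ^ 2 ^ 2"
  assumes det: "det a = 1" "det b = 1" "det c = 1"
    and tr: "trace b = trace a" "trace c = trace a"
    and neq: "a \<noteq> b" "a \<noteq> c" "b \<noteq> c"
    and line: "\<And>i j. c $ i $ j = a $ i $ j + s * (b $ i $ j - a $ i $ j)"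
  shows "common_eigvec {a, b, c}"
proof -
  define d where "d = b - a"
  have s: "s \<noteq> 0" "s \<noteq> 1" using line neq by (auto simp: vec_eq_iff)
  have trd: "trace d = 0" using tr by (simp add: d_def trace_sub)
  obtain a1 a2 a3 a4 where a: "a $ 1 $ 1 = a1" "a $ 1 $ 2 = a2" "a $ 2 $ 1 = a3" "a $ 2 $ 2 = a4"
    by (rule mat2_entries)
  obtain d1 d2 d3 d4 where "d $ 1 $ 1 = d1" "d $ 1 $ 2 = d2" "d $ 2 $ 1 = d3" "d $ 2 $ 2 = d4"
    by (rule mat2_entries)
  moreover from this have "d4 = - d1" using trd by (simp add: mat2_simps add_eq_0_iff)
  ultimately have d: "d $ 1 $ 1 = d1" "d $ 1 $ 2 = d2" "d $ 2 $ 1 = d3" "d $ 2 $ 2 = - d1" by auto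
  have b: "b $ i $ j = a $ i $ j + d $ i $ j" for i j by (simp add: d_def)
  have c: "c $ i $ j = a $ i $ j + s * d $ i $ j" for i j by (simp add: d_def line)
  have da: "a1 * a4 - a2 * a3 = 1"
    using det(1) by (simp add: det_2 a)
  have db: "(a1 + d1) * (a4 + - d1) - (a2 + d2) * (a3 + d3) = 1"
    using det(2) by (simp add: det_2 a b d)
  have dc: "(a1 + s * d1) * (a4 + s * - d1) - (a2 + s * d2) * (a3 + s * d3) = 1"
    using det(3) unfolding det_2 a b c d .
  have "s * ((s - 1) * (d1 * d1 + d2 * d3)) = 0"
    using da db dc by Groebner_Basis.algebra
  with s have d0: "d1 * d1 + d2 * d3 = 0" by simp
  then have "det d = 0" by (simp add: det_2 d add_eq_0_iff)
  have "d \<noteq> 0" using neq by (simp add: d_def)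
  then obtain v where v: "v \<noteq> 0" "\<And>a. trace (d ** a) = 0 \<Longrightarrow> \<exists>c. a *v v = c *s v"
    using nilpotent_kernel_eigenvector trd \<open>det d = 0\<close> by blast
  \<comment> \<open>Since \<open>trace d = 0\<close>, the linear coefficient of that polynomial is
    \<open>- trace (d ** a)\<close>.\<close>
  have ad: "d1 * a1 + d2 * a3 + (d3 * a2 + - d1 * a4) = 0"
    using da db d0 by Groebner_Basis.algebra
  then have "trace (d ** a) = 0"
    by (simp add: mat2_simps a d)
  \<comment> \<open>\<open>trace (d ** d) = - 2 * det d = 0\<close>, so the orthogonality passes
    from \<open>a\<close> to every point of the line.\<close>
  moreover have "d1 * (a1 + d1) + d2 * (a3 + d3) + (d3 * (a2 + d2) + - d1 * (a4 + - d1)) = 0"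
    using ad d0 by Groebner_Basis.algebra
  then have "trace (d ** b) = 0"
    by (simp add: mat2_simps a b d)
  moreover have "d1 * (a1 + s * d1) + d2 * (a3 + s * d3) + (d3 * (a2 + s * d2) + - d1 * (a4 + s * - d1)) = 0"
    using ad d0 by Groebner_Basis.algebra
  then have "trace (d ** c) = 0"
    by (simp add: mat2_simps a c d)
  ultimately show ?thesis using v unfolding common_eigvec_def by blast
qed

text \<open>The identity is a third solution besides \<open>q\<close> and \<open>r\<close>. Unless
  \<open>a\<close>, \<open>b\<close>, \<open>c\<close> are collinear, all solutions lie on a line
  \<open>1 + s m\<close>. As \<open>1 + s * trace m + s^2 * det m\<close> is 1 at two distinct
  nonzero values of \<open>s\<close>, \<open>m\<close> is nilpotent.\<close>

lemma three_solutions_common_eigenvector: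
  fixes a b c q r :: "'k::field ^ 2 ^ 2"
  assumes det: "det a = 1" "det b = 1" "det c = 1"
    and tr: "trace a = t" "trace b = t" "trace c = t" "t \<noteq> 0"
    and neq: "a \<noteq> b" "a \<noteq> c" "b \<noteq> c"
    and q: "det q = 1" "trace (q ** a) = t" "trace (q ** b) = t" "trace (q ** c) = t"
    and r: "det r = 1" "trace (r ** a) = t" "trace (r ** b) = t" "trace (r ** c) = t"
    and qr: "q \<noteq> mat 1" "r \<noteq> mat 1" "q \<noteq> r"
  shows "common_eigvec {a, b, c}"
proof -
  have ex: "\<exists>x1 x2 x3. x $ 1 $ 1 = x1 \<and> x $ 1 $ 2 = x2 \<and> x $ 2 $ 1 = x3 \<and> x $ 2 $ 2 = t - x1"
    if "trace x = t" for x :: "'k ^ 2 ^ 2"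
    using that by (auto simp: trace_def sum_2)
  obtain a1 a2 a3 where a: "a $ 1 $ 1 = a1" "a $ 1 $ 2 = a2" "a $ 2 $ 1 = a3" "a $ 2 $ 2 = t - a1"
    using ex[OF tr(1)] by blast
  obtain b1 b2 b3 where b: "b $ 1 $ 1 = b1" "b $ 1 $ 2 = b2" "b $ 2 $ 1 = b3" "b $ 2 $ 2 = t - b1"
    using ex[OF tr(2)] by blast
  obtain c1 c2 c3 where c: "c $ 1 $ 1 = c1" "c $ 1 $ 2 = c2" "c $ 2 $ 1 = c3" "c $ 2 $ 2 = t - c1"
    using ex[OF tr(3)] by blast
  \<comment> \<open>The cross product of \<open>b - a\<close> and \<open>c - a\<close>, in the
    entries that determine a matrix of fixed trace.\<close>
  define n1 n2 n3 where "n1 = (b2 - a2) * (c3 - a3) - (b3 - a3) * (c2 - a2)"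
    and "n2 = (b3 - a3) * (c1 - a1) - (b1 - a1) * (c3 - a3)"
    and "n3 = (b1 - a1) * (c2 - a2) - (b2 - a2) * (c1 - a1)"
  note n_defs = n1_def n2_def n3_def
  show ?thesis
  proof (cases "n1 = 0 \<and> n2 = 0 \<and> n3 = 0")
    case True
    have "b1 - a1 \<noteq> 0 \<or> b2 - a2 \<noteq> 0 \<or> b3 - a3 \<noteq> 0"
      using neq(1) a b by (auto simp: vec_eq_iff forall_2)
    then obtain s where s: "c1 - a1 = s * (b1 - a1)" "c2 - a2 = s * (b2 - a2)" "c3 - a3 = s * (b3 - a3)"
      using True unfolding n_defs
      by (rule_tac parallel_triple[of "b1 - a1" "b2 - a2" "b3 - a3" "c2 - a2" "c1 - a1" "c3 - a3"])
        (auto simp: mult.commute)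
    have "t - c1 = t - a1 + s * (t - b1 - (t - a1))" using s(1) by Groebner_Basis.algebra
    moreover have "c1 = a1 + s * (b1 - a1)" "c2 = a2 + s * (b2 - a2)" "c3 = a3 + s * (b3 - a3)"
      using s by (simp_all flip: s)
    ultimately have "\<forall>i j. c $ i $ j = a $ i $ j + s * (b $ i $ j - a $ i $ j)"
      unfolding forall_2 a b c by blast
    then show ?thesis
      using collinear_common_eigenvector[OF det _ _ neq, of s] tr by metis
  next
    case False
    \<comment> \<open>This \<open>k\<close> makes \<open>trace (m ** a) = 0\<close>, which needs
      \<open>t\<close> nonzero. In \<open>m\<close> the entries \<open>n2\<close> and
      \<open>n3\<close> are transposed, as the trace pairing demands.\<close>
    define k where "k = (n1 * a1 + n2 * a2 + n3 * a3) / t"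
    have k: "k * t = n1 * a1 + n2 * a2 + n3 * a3"
      using tr(4) by (simp add: k_def)
    define m :: "'k ^ 2 ^ 2" where "m = vector [vector [n1 - k, n3], vector [n2, - k]]"
    have m: "m $ 1 $ 1 = n1 - k" "m $ 1 $ 2 = n3" "m $ 2 $ 1 = n2" "m $ 2 $ 2 = - k"
      by (auto simp: m_def)
    have mult: "\<exists>s. (\<forall>i j. z $ i $ j = mat 1 $ i $ j + s * m $ i $ j) \<and> s \<noteq> 0 \<and> trace m + s * det m = 0"
      if z: "det z = 1" "trace (z ** a) = t" "trace (z ** b) = t" "trace (z ** c) = t" "z \<noteq> mat 1" for z
    proof -
      obtain z1 z2 z3 z4 where z_eq: "z $ 1 $ 1 = z1" "z $ 1 $ 2 = z2" "z $ 2 $ 1 = z3" "z $ 2 $ 2 = z4"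
        by (rule mat2_entries)
      have za: "z1 * a1 + z2 * a3 + (z3 * a2 + z4 * (t - a1)) = t"
        using z(2) by (simp add: mat2_simps a z_eq)
      have zb: "z1 * b1 + z2 * b3 + (z3 * b2 + z4 * (t - b1)) = t"
        using z(3) by (simp add: mat2_simps b z_eq)
      have zc: "z1 * c1 + z2 * c3 + (z3 * c2 + z4 * (t - c1)) = t"
        using z(4) by (simp add: mat2_simps c z_eq)
      \<comment> \<open>Differences of the trace equations make \<open>(z1 - z4, z3, z2)\<close>
        orthogonal to \<open>b - a\<close> and \<open>c - a\<close>, hence parallel to their cross
        product.\<close>
      have xd: "(z1 - z4) * (b1 - a1) + z3 * (b2 - a2) + z2 * (b3 - a3) = 0"
        using arg_cong2[OF zb za, of "(-)"] by (simp add: algebra_simps)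
      have xe: "(z1 - z4) * (c1 - a1) + z3 * (c2 - a2) + z2 * (c3 - a3) = 0"
        using arg_cong2[OF zc za, of "(-)"] by (simp add: algebra_simps)
      have "n1 * z3 = n2 * (z1 - z4)" "n1 * z2 = n3 * (z1 - z4)" "n2 * z2 = n3 * z3"
        using xd xe unfolding n_defs by Groebner_Basis.algebra+
      then obtain s where s: "z1 - z4 = s * n1" "z3 = s * n2" "z2 = s * n3"
        using parallel_triple False by metis
      have "(z1 - z4) * a1 + z3 * a2 + z2 * a3 + z4 * t = t"
        using za by (simp add: algebra_simps)
      moreover have "(z1 - z4) * a1 + z3 * a2 + z2 * a3 = s * (k * t)"
        unfolding s k by (simp add: algebra_simps)
      ultimately have "s * (k * t) + z4 * t = t" by (simp only:)
      then have "(s * k + z4) * t = 1 * t" by (simp add: algebra_simps)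
      then have "s * k + z4 = 1" using tr(4) by (metis mult_right_cancel)
      then have z4: "z4 = 1 + s * - k" by (simp add: eq_diff_eq algebra_simps)
      moreover have z1: "z1 = 1 + s * (n1 - k)" using s(1) z4 by Groebner_Basis.algebra
      ultimately have all: "\<forall>i j. z $ i $ j = mat 1 $ i $ j + s * m $ i $ j"
        using s by (simp add: forall_2 mat_def z_eq m)
      moreover have s0: "s \<noteq> 0" using all z(5) by (auto simp: vec_eq_iff)
      moreover have "z1 * z4 - z2 * z3 = 1" using z(1) by (simp add: det_2 z_eq)
      then have "s * (n1 - k + - k + s * ((n1 - k) * (- k) - n3 * n2)) = 0"
        using s(2,3) z1 z4 by Groebner_Basis.algebra
      then have "trace m + s * det m = 0" using s0 by (simp add: det_2 trace_def sum_2 m)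
      ultimately show ?thesis by auto
    qed
    obtain s where s: "\<And>i j. q $ i $ j = mat 1 $ i $ j + s * m $ i $ j" "s \<noteq> 0" "trace m + s * det m = 0"
      using mult q qr(1) by metis
    obtain s' where s': "\<And>i j. r $ i $ j = mat 1 $ i $ j + s' * m $ i $ j" "s' \<noteq> 0" "trace m + s' * det m = 0"
      using mult r qr(2) by metis
    have "s \<noteq> s'" using s s' qr(3) by (auto simp: vec_eq_iff)
    moreover have "s * det m = s' * det m" using s(3) s'(3) by (metis add_left_cancel)
    ultimately have "det m = 0" by simp
    with s(3) have "trace m = 0" by simp
    have "m \<noteq> 0" using s(1) qr(1) by (auto simp: vec_eq_iff)
    have orth: "trace (m ** z) = 0" if "trace (q ** z) = t" "trace z = t" for z
    proof -
      have "s * trace (m ** z) = trace (q ** z) - trace z"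
        by (simp add: mat2_simps s(1) algebra_simps)
      then show ?thesis using that s(2) by simp
    qed
    show ?thesis
      using nilpotent_kernel_eigenvector[OF \<open>m \<noteq> 0\<close> \<open>trace m = 0\<close> \<open>det m = 0\<close>] orth q tr
      unfolding common_eigvec_def by (metis insertE singletonD)
  qed
qed

section \<open>Inverses, eigenvectors and eigenvalues in \<open>SL2\<close>\<close>

lemma SL2_inverse:
  fixes A :: "'k::field ^ 2 ^ 2"
  assumes "det A = 1"
  obtains B where "A ** B = mat 1" "B ** A = mat 1" "det B = 1" "trace B = trace A"
proof -
  \<comment> \<open>The adjugate: it inverts \<open>A\<close> because \<open>det A = 1\<close>, and
    it visibly has the same trace.\<close>
  define B :: "'k ^ 2 ^ 2"
    where "B = vector [vector [A $ 2 $ 2, - A $ 1 $ 2], vector [- A $ 2 $ 1, A $ 1 $ 1]]"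
  have "A ** B = mat 1" "B ** A = mat 1" "det B = 1" "trace B = trace A"
    using assms by (simp_all add: B_def mat2_simps algebra_simps)
  then show ?thesis by (rule that)
qed

lemma SL2_mult_cancel:
  fixes A :: "'k::field ^ 2 ^ 2"
  assumes "det A = 1"
  shows "A ** B = A ** C \<longleftrightarrow> B = C" "B ** A = C ** A \<longleftrightarrow> B = C" "A *v v = A *v w \<longleftrightarrow> v = w"
proof -
  obtain A' where A': "A ** A' = mat 1" "A' ** A = mat 1"
    using SL2_inverse[OF assms] by blast
  show "A ** B = A ** C \<longleftrightarrow> B = C" using A' by (metis matrix_mul_assoc matrix_mul_lid)
  show "B ** A = C ** A \<longleftrightarrow> B = C" using A' by (metis matrix_mul_assoc matrix_mul_rid)
  show "A *v v = A *v w \<longleftrightarrow> v = w" using A' by (metis matrix_vector_mul_assoc matrix_vector_mul_lid)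
qed

lemma eigenvalue_SL2_nonzero:
  fixes A :: "'k::field ^ 2 ^ 2"
  assumes "det A = 1" "v \<noteq> 0" "A *v v = l *s v"
  shows "l \<noteq> 0"
proof
  assume "l = 0"
  with assms(3) have "A *v v = A *v 0" by simp
  with SL2_mult_cancel(3)[OF assms(1)] assms(2) show False by blast
qed

lemma mat2_eq_on_basis:
  fixes A B :: "'k::field ^ 2 ^ 2"
  assumes v: "v \<noteq> 0" and w: "\<nexists>c. w = c *s v"
    and "A *v v = B *v v" "A *v w = B *v w"
  shows "A = B"
proof -
  obtain v1 v2 where v_eq: "v $ 1 = v1" "v $ 2 = v2" by blast
  obtain w1 w2 where w_eq: "w $ 1 = w1" "w $ 2 = w2" by blast
  have D: "v1 * w2 - v2 * w1 \<noteq> 0"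
    using parallel_vec2[OF v, of w] w by (auto simp: v_eq w_eq)
  have row: "p = p' \<and> q = q'"
    if "p * v1 + q * v2 = p' * v1 + q' * v2" "p * w1 + q * w2 = p' * w1 + q' * w2" for p q p' q'
  proof -
    have "(v1 * w2 - v2 * w1) * (p - p') = 0" "(v1 * w2 - v2 * w1) * (q - q') = 0"
      using that by Groebner_Basis.algebra+
    with D show ?thesis by simp
  qed
  have "A $ i $ 1 = B $ i $ 1 \<and> A $ i $ 2 = B $ i $ 2" for i
  proof (rule row)
    show "A $ i $ 1 * v1 + A $ i $ 2 * v2 = B $ i $ 1 * v1 + B $ i $ 2 * v2"
      using arg_cong[OF assms(3), of "\<lambda>u. u $ i"] by (simp add: matrix_vector_mult_def sum_2 v_eq)
    show "A $ i $ 1 * w1 + A $ i $ 2 * w2 = B $ i $ 1 * w1 + B $ i $ 2 * w2"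
      using arg_cong[OF assms(4), of "\<lambda>u. u $ i"] by (simp add: matrix_vector_mult_def sum_2 w_eq)
  qed
  then show ?thesis by (simp add: vec_eq_iff forall_2)
qed

lemma mat_vector_mult: "mat c *v v = c *s (v :: 'k::field ^ 2)"
  by (simp add: mat2_simps)

text \<open>If \<open>w\<close> were independent of \<open>v\<close>, then \<open>A\<close> would
  agree with the scalar \<open>l\<close> on a basis.\<close>

lemma eigvec_unique:
  fixes A :: "'k::field ^ 2 ^ 2"
  assumes "\<nexists>c. A = mat c" "v \<noteq> 0" "A *v v = l *s v" "A *v w = l *s w"
  shows "\<exists>c. w = c *s v"
  using mat2_eq_on_basis[OF assms(2), of w A "mat l"] assms by (auto simp: mat_vector_mult)

lemma eigenvalue_SL2_root:
  fixes A :: "'k::field ^ 2 ^ 2"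
  assumes "det A = 1" "v \<noteq> 0" "A *v v = l *s v"
  shows "l * l - trace A * l + 1 = 0"
proof -
  obtain p q r s where A: "A $ 1 $ 1 = p" "A $ 1 $ 2 = q" "A $ 2 $ 1 = r" "A $ 2 $ 2 = s"
    by (rule mat2_entries)
  obtain v1 v2 where v_eq: "v $ 1 = v1" "v $ 2 = v2" by blast
  have det: "p * s - q * r = 1" using assms(1) by (simp add: det_2 A)
  have v: "p * v1 + q * v2 = l * v1" "r * v1 + s * v2 = l * v2"
    using assms(3) by (auto simp: mat2_simps A v_eq)
  have "(l * l - (p + s) * l + 1) * v1 = 0" "(l * l - (p + s) * l + 1) * v2 = 0"
    using det v by Groebner_Basis.algebra+
  moreover have "v1 \<noteq> 0 \<or> v2 \<noteq> 0"
    using assms(2) by (auto simp: vec_eq_iff forall_2 v_eq)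
  ultimately show ?thesis by (auto simp: trace_def sum_2 A)
qed

lemma char_poly_SL2_roots:
  fixes t :: "'k::field"
  shows "finite {l. l * l - t * l + 1 = 0}" "card {l. l * l - t * l + 1 = 0} \<le> 2"
proof -
  have "\<exists>l0. {l. l * l - t * l + 1 = 0} \<subseteq> {l0, t - l0}"
  proof (cases "\<exists>l0. l0 * l0 - t * l0 + 1 = 0")
    case True
    then obtain l0 where l0: "l0 * l0 - t * l0 + 1 = 0" by blast
    have "l = l0 \<or> l = t - l0" if "l * l - t * l + 1 = 0" for l
    proof -
      \<comment> \<open>The two roots sum to \<open>t\<close>.\<close>
      have "(l - l0) * (l - (t - l0)) = 0" using l0 that by Groebner_Basis.algebra
      then show ?thesis by simp
    qed
    then show ?thesis by blast
  qed blast
  then obtain l0 where sub: "{l. l * l - t * l + 1 = 0} \<subseteq> {l0, t - l0}" by blast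
  show "finite {l. l * l - t * l + 1 = 0}" using sub by (rule finite_subset) simp
  have "card {l. l * l - t * l + 1 = 0} \<le> card {l0, t - l0}" using sub by (intro card_mono) auto
  also have "\<dots> \<le> 2" by (simp add: card_insert_if)
  finally show "card {l. l * l - t * l + 1 = 0} \<le> 2" .
qed

section \<open>Counting matrices with a prescribed eigenvector\<close>

text \<open>The factor 4 counts pairs of roots of \<open>l^2 - t l + 1\<close>: an eigenvalue of
  \<open>x\<close>, which fixes the eigenline since \<open>x\<close> is not scalar, and the
  eigenvalue of \<open>y\<close> on that line.\<close>

lemma card_common_eigvec_le:
  fixes A :: "('k::field ^ 2 ^ 2) set" and M :: real
  assumes A: "finite A" "\<And>y. y \<in> A \<Longrightarrow> det y = 1 \<and> trace y = t"
    and x: "det x = 1" "trace x = t" "\<nexists>c. x = mat c"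
    and M: "\<And>v l. v \<noteq> 0 \<Longrightarrow> real (card {y \<in> A. y *v v = l *s v}) \<le> M"
  shows "real (card {y \<in> A. common_eigvec {x, y}}) \<le> 4 * M"
proof -
  define R where "R = {l. l * l - t * l + 1 = 0}"
  have R: "finite R" "card R \<le> 2" unfolding R_def by (rule char_poly_SL2_roots)+
  \<comment> \<open>\<open>V l\<close> is arbitrary if \<open>l\<close> is no eigenvalue of
    \<open>x\<close>; the guard \<open>V l \<noteq> 0\<close> in \<open>Y\<close> makes the bound
    \<open>M\<close> applicable all the same.\<close>
  define V where "V l = (SOME v. v \<noteq> 0 \<and> x *v v = l *s v)" for l
  define Y where "Y = (\<lambda>(l, m). {y \<in> A. V l \<noteq> 0 \<and> y *v V l = m *s V l})"
  have M0: "M \<ge> 0" using M[of "axis 1 1" 0] by (simp add: axis_eq_0_iff)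
  have Y: "real (card (Y i)) \<le> M" for i
  proof (cases "V (fst i) = 0")
    case False
    then show ?thesis using M[of "V (fst i)" "snd i"] by (auto simp: Y_def split: prod.split)
  qed (use M0 in \<open>auto simp: Y_def split: prod.split\<close>)
  have "{y \<in> A. common_eigvec {x, y}} \<subseteq> (\<Union>i\<in>R \<times> R. Y i)"
  proof
    fix y assume "y \<in> {y \<in> A. common_eigvec {x, y}}"
    then obtain w l m where y: "y \<in> A" and w: "w \<noteq> 0" "x *v w = l *s w" "y *v w = m *s w"
      unfolding common_eigvec_def by blast
    have V: "V l \<noteq> 0" "x *v V l = l *s V l"
      using someI[of "\<lambda>v. v \<noteq> 0 \<and> x *v v = l *s v" w] w unfolding V_def by auto
    then obtain c where c: "V l = c *s w"
      using eigvec_unique[OF x(3) w(1,2)] by blast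
    then have "y *v V l = m *s V l"
      using w(3) by (simp add: vector_scalar_commute mult.commute)
    moreover have "l \<in> R" "m \<in> R"
      using eigenvalue_SL2_root[OF x(1) w(1,2)] eigenvalue_SL2_root[OF _ w(1,3)] A(2)[OF y] x(2)
      by (simp_all add: R_def)
    ultimately show "y \<in> (\<Union>i\<in>R \<times> R. Y i)"
      using y V by (auto simp: Y_def)
  qed
  then have "card {y \<in> A. common_eigvec {x, y}} \<le> card (\<Union>i\<in>R \<times> R. Y i)"
    using A(1) R(1) by (intro card_mono) (auto simp: Y_def)
  also have "\<dots> \<le> (\<Sum>i\<in>R \<times> R. card (Y i))"
    using R(1) by (intro card_UN_le) simp
  finally have "real (card {y \<in> A. common_eigvec {x, y}}) \<le> (\<Sum>i\<in>R \<times> R. real (card (Y i)))"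
    by (simp flip: of_nat_sum)
  also have "\<dots> \<le> real (card (R \<times> R)) * M"
    using Y by (intro sum_bounded_above) auto
  also have "card (R \<times> R) \<le> 2 * 2"
    using mult_le_mono[OF R(2) R(2)] by (simp add: card_cartesian_product)
  then have "real (card (R \<times> R)) * M \<le> 4 * M"
    using M0 by (intro mult_right_mono) auto
  finally show ?thesis .
qed

text \<open>Applying \<open>x ** h ** y\<close> to \<open>v\<close> gives
  \<open>l *s (x *v (h *v v))\<close> with \<open>l\<close> nonzero. So the product determines
  \<open>x\<close> on the basis \<open>v\<close>, \<open>h *v v\<close>, and then \<open>y\<close>
  by cancellation.\<close>

lemma card_eigvec_stabilizer_le:
  fixes H :: "('k::field ^ 2 ^ 2) set"
  assumes H: "finite H" "H \<subseteq> carrier SL2"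
    and v: "v \<noteq> 0" and h: "h \<in> H" "\<nexists>c. h *v v = c *s v"
  shows "card {x \<in> H. x *v v = l *s v} ^ 2 \<le> card (H <#>\<^bsub>SL2\<^esub> H <#>\<^bsub>SL2\<^esub> H)"
proof -
  define S where "S = {x \<in> H. x *v v = l *s v}"
  have det: "det x = 1" if "x \<in> H" for x using that H(2) by (auto simp: SL2_def)
  define f where "f = (\<lambda>(x, y). x ** h ** y :: 'k ^ 2 ^ 2)"
  have "inj_on f (S \<times> S)"
  proof (rule inj_onI, clarify)
    fix x y x' y'
    assume S: "x \<in> S" "y \<in> S" "x' \<in> S" "y' \<in> S" and "f (x, y) = f (x', y')"
    then have eq: "x ** h ** y = x' ** h ** y'" by (simp add: f_def)
    from S have HS: "x \<in> H" "x' \<in> H" "y \<in> H" by (auto simp: S_def)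
    have "x *v (h *v (y *v v)) = x' *v (h *v (y' *v v))"
      using eq by (simp add: matrix_vector_mul_assoc matrix_mul_assoc)
    then have "l *s (x *v (h *v v)) = l *s (x' *v (h *v v))"
      using S by (simp add: S_def vector_scalar_commute)
    moreover have "l \<noteq> 0"
      using eigenvalue_SL2_nonzero[OF det v, of x l] S by (simp add: S_def)
    ultimately have "x *v (h *v v) = x' *v (h *v v)" by simp
    moreover have "x *v v = x' *v v" using S by (simp add: S_def)
    ultimately have "x = x'" using mat2_eq_on_basis[OF v h(2)] by blast
    moreover have "det (x ** h) = 1" using det HS h by (simp add: det_mul)
    ultimately show "x = x' \<and> y = y'" using eq SL2_mult_cancel(1) by metis
  qed
  then have "card (S \<times> S) = card (f ` (S \<times> S))" by (simp add: card_image)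
  also have "f ` (S \<times> S) \<subseteq> H <#>\<^bsub>SL2\<^esub> H <#>\<^bsub>SL2\<^esub> H"
    using h(1) by (force simp: f_def S_def set_mult_def SL2_def)
  then have "card (f ` (S \<times> S)) \<le> card (H <#>\<^bsub>SL2\<^esub> H <#>\<^bsub>SL2\<^esub> H)"
    using H(1) by (intro card_mono) (auto simp: set_mult_def)
  finally show ?thesis
    by (simp add: S_def card_cartesian_product power2_eq_square)
qed

section \<open>Fibres of the product map and the count of triples\<close>

lemma common_eigvec_inverse:
  fixes x :: "'k::field ^ 2 ^ 2"
  assumes "x ** a = mat 1" "det a = 1" "common_eigvec (insert a S)"
  shows "common_eigvec (insert x S)"
proof -
  obtain v c where v: "v \<noteq> 0" "a *v v = c *s v" "\<forall>y\<in>S. \<exists>c. y *v v = c *s v"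
    using assms(3) unfolding common_eigvec_def by blast
  have c: "c \<noteq> 0" using eigenvalue_SL2_nonzero assms(2) v by blast
  have "v = x *v (a *v v)" by (simp add: matrix_vector_mul_assoc assms(1))
  then have "inverse c *s v = x *v v"
    using v(2) c by (metis vector_scalar_commute vector_smult_assoc left_inverse vector_smult_lid)
  then show ?thesis using v unfolding common_eigvec_def by (metis insertE)
qed

text \<open>Put \<open>q = x'^-1 x\<close>. Left multiplication by \<open>q\<close> sends
  \<open>x^-1\<close>, \<open>y\<close>, \<open>z\<close> to \<open>x'^-1\<close>,
  \<open>y'\<close>, \<open>z'\<close>, all of trace \<open>t\<close>; likewise for the third
  triple. Three distinct first entries would give three solutions 1, \<open>q\<close>,
  \<open>r\<close> of the trace equations.\<close>

lemma fibre_no_three_triples: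
  fixes x y z x' y' z' x'' y'' z'' :: "'k::field ^ 2 ^ 2"
  assumes B: "\<And>u. u \<in> {x, y, z, x', y', z', x'', y'', z''} \<Longrightarrow> det u = 1 \<and> trace u = t" "t \<noteq> 0"
    and eq: "x' ** y' = x ** y" "x' ** z' = x ** z" "x'' ** y'' = x ** y" "x'' ** z'' = x ** z"
    and good: "x ** y \<noteq> mat 1" "x ** z \<noteq> mat 1" "y \<noteq> z" "\<not> common_eigvec {x, y, z}"
  shows "x' = x \<or> x'' = x \<or> x' = x''"
proof (rule ccontr)
  assume ne: "\<not> ?thesis"
  have det: "det x = 1" "det y = 1" "det z = 1" "det x' = 1" "det x'' = 1"
    and tr: "trace x = t" "trace y = t" "trace z = t" "trace x' = t" "trace x'' = t"
      "trace y' = t" "trace z' = t" "trace y'' = t" "trace z'' = t"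
    using B(1) by blast+
  obtain a where a: "x ** a = mat 1" "a ** x = mat 1" "det a = 1" "trace a = t"
    using SL2_inverse[OF det(1)] tr by metis
  obtain a' where a': "x' ** a' = mat 1" "a' ** x' = mat 1" "det a' = 1" "trace a' = t"
    using SL2_inverse[OF det(4)] tr by metis
  obtain a'' where a'': "x'' ** a'' = mat 1" "a'' ** x'' = mat 1" "det a'' = 1" "trace a'' = t"
    using SL2_inverse[OF det(5)] tr by metis
  have inv_inj: "u = w" if "u ** b = mat 1" "w ** b = mat 1" "det b = 1" for u w b :: "'k ^ 2 ^ 2"
    using that SL2_mult_cancel(2) by metis
  have "a' ** x ** a = a'" "a' ** x ** y = y'" "a' ** x ** z = z'"
    by (metis a(1) a'(2) eq(1,2) matrix_mul_assoc matrix_mul_lid matrix_mul_rid)+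
  moreover have "a'' ** x ** a = a''" "a'' ** x ** y = y''" "a'' ** x ** z = z''"
    by (metis a(1) a''(2) eq(3,4) matrix_mul_assoc matrix_mul_lid matrix_mul_rid)+
  moreover have "a' ** x \<noteq> mat 1" "a'' ** x \<noteq> mat 1"
    using ne SL2_mult_cancel(1)[OF a'(3)] SL2_mult_cancel(1)[OF a''(3)] a'(2) a''(2) by metis+
  moreover have "a' ** x \<noteq> a'' ** x"
    using ne SL2_mult_cancel(2)[OF det(1)] inv_inj[OF a'(1) _ a'(3)] a''(1) by metis
  moreover have "a \<noteq> y" "a \<noteq> z" using good a by auto
  ultimately have "common_eigvec {a, y, z}"
    using three_solutions_common_eigenvector[of a y z t "a' ** x" "a'' ** x"]
      a a' a'' det tr B(2) good(3) by (simp add: det_mul)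
  with good(4) common_eigvec_inverse a show False by blast
qed

lemma card_le_mult_card_image:
  assumes "finite S" "\<And>y. y \<in> f ` S \<Longrightarrow> card {x \<in> S. f x = y} \<le> k"
  shows "card S \<le> k * card (f ` S)"
proof -
  have "card S = card (\<Union>y\<in>f ` S. {x \<in> S. f x = y})" by (rule arg_cong[of _ _ card]) auto
  also have "\<dots> \<le> (\<Sum>y\<in>f ` S. card {x \<in> S. f x = y})" using assms(1) by (intro card_UN_le) simp
  also have "\<dots> \<le> card (f ` S) * k" using sum_bounded_above[of "f ` S" _ k] assms(2) by simp
  finally show ?thesis by (simp add: mult.commute)
qed

text \<open>The terms bound the triples with \<open>x y = 1\<close>, \<open>x z = 1\<close> or
  \<open>y = z\<close>, those with a common eigenvector (at most \<open>4 * sqrt T\<close> choices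
  each for \<open>y\<close> and \<open>z\<close>), and the remaining ones, whose fibres have at most
  two points.\<close>

lemma card_trace_set_cubed_le:
  fixes H A :: "('k::field ^ 2 ^ 2) set"
  assumes H: "finite H" "H \<subseteq> carrier SL2" "\<one>\<^bsub>SL2\<^esub> \<in> H"
    and no_line: "\<And>v. v \<noteq> 0 \<Longrightarrow> \<exists>h\<in>H. \<nexists>c. h *v v = c *s v"
    and A: "A \<subseteq> H" "\<And>x. x \<in> A \<Longrightarrow> trace x = t" "t \<noteq> 0" "\<And>x c. x \<in> A \<Longrightarrow> x \<noteq> mat c"
  defines "N \<equiv> real (card A)" and "T \<equiv> real (card (H <#>\<^bsub>SL2\<^esub> H <#>\<^bsub>SL2\<^esub> H))"
  shows "N ^ 3 \<le> 3 * N ^ 2 + 16 * T * N + 2 * T ^ 2"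
proof -
  have finA: "finite A" using A(1) H(1) finite_subset by blast
  have det: "det x = 1" if "x \<in> A" for x using that A(1) H(2) by (auto simp: SL2_def)
  have HHH: "H <#>\<^bsub>SL2\<^esub> H \<subseteq> H <#>\<^bsub>SL2\<^esub> H <#>\<^bsub>SL2\<^esub> H"
    using H(3) by (force simp: set_mult_def SL2_def)
  have fin3: "finite (H <#>\<^bsub>SL2\<^esub> H <#>\<^bsub>SL2\<^esub> H)" using H(1) by (simp add: set_mult_def)
  define E where "E x = {y \<in> A. common_eigvec {x, y}}" for x
  have stab: "real (card {y \<in> A. y *v v = l *s v}) \<le> sqrt T" if v: "v \<noteq> 0" for v l
  proof -
    obtain h where h: "h \<in> H" "\<nexists>c. h *v v = c *s v" using no_line[OF v] by blast
    have "card {y \<in> A. y *v v = l *s v} \<le> card {y \<in> H. y *v v = l *s v}"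
      using A(1) H(1) by (intro card_mono) auto
    then have "card {y \<in> A. y *v v = l *s v} ^ 2 \<le> card (H <#>\<^bsub>SL2\<^esub> H <#>\<^bsub>SL2\<^esub> H)"
      using card_eigvec_stabilizer_le[OF H(1,2) v h, of l] power_mono order_trans by blast
    then have "real (card {y \<in> A. y *v v = l *s v}) ^ 2 \<le> T"
      unfolding T_def by (simp flip: of_nat_power)
    then show ?thesis by (rule real_le_rsqrt)
  qed
  have E: "real (card (E x \<times> E x)) \<le> 16 * T" if "x \<in> A" for x
  proof -
    have "real (card (E x)) \<le> 4 * sqrt T"
      unfolding E_def
      by (rule card_common_eigvec_le[where t = t]) (use that finA A det stab in auto)
    then have "real (card (E x)) * real (card (E x)) \<le> (4 * sqrt T) * (4 * sqrt T)"
      by (intro mult_mono) (auto simp: T_def)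
    also have "\<dots> = 16 * T" by (simp add: T_def)
    finally show ?thesis by (simp add: card_cartesian_product)
  qed
  define G where "G = {(x, y, z). x \<in> A \<and> y \<in> A \<and> z \<in> A \<and> x ** y \<noteq> mat 1 \<and> x ** z \<noteq> mat 1
      \<and> y \<noteq> z \<and> \<not> common_eigvec {x, y, z}}"
  have finG: "finite G"
    by (rule finite_subset[of _ "A \<times> A \<times> A"]) (use finA in \<open>auto simp: G_def\<close>)
  define f where "f = (\<lambda>(x :: 'k ^ 2 ^ 2, y :: 'k ^ 2 ^ 2, z :: 'k ^ 2 ^ 2). (x ** y, x ** z))"
  have "card {u \<in> G. f u = w} \<le> 2" for w
  proof (rule ccontr)
    assume "\<not> ?thesis"
    then have "3 \<le> card {u \<in> G. f u = w}" by simp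
    then obtain S where S: "S \<subseteq> {u \<in> G. f u = w}" "card S = 3"
      by (rule obtain_subset_with_card_n)
    then obtain u u' u'' where u: "S = {u, u', u''}" "u \<noteq> u'" "u' \<noteq> u''" "u \<noteq> u''"
      unfolding card_3_iff by blast
    obtain x y z x' y' z' x'' y'' z'' where
      u_eq: "u = (x, y, z)" "u' = (x', y', z')" "u'' = (x'', y'', z'')"
      by (metis prod_cases3)
    have G: "(x, y, z) \<in> G" "(x', y', z') \<in> G" "(x'', y'', z'') \<in> G"
      and f: "f (x, y, z) = w" "f (x', y', z') = w" "f (x'', y'', z'') = w"
      using S(1) u(1) u_eq by auto
    have inA: "{x, y, z, x', y', z', x'', y'', z''} \<subseteq> A" using G by (auto simp: G_def)
    have eq: "x' ** y' = x ** y" "x' ** z' = x ** z" "x'' ** y'' = x ** y" "x'' ** z'' = x ** z"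
      using f by (auto simp: f_def)
    have "x' = x \<or> x'' = x \<or> x' = x''"
      by (rule fibre_no_three_triples[OF _ A(3) eq])
        (use G inA A(2) det in \<open>auto simp: G_def\<close>)
    moreover have "det x = 1" "det x' = 1" using inA det by auto
    \<comment> \<open>Within a fibre the first entry determines the whole triple.\<close>
    ultimately have "u' = u \<or> u'' = u \<or> u' = u''"
      using eq SL2_mult_cancel(1) unfolding u_eq by metis
    with u show False by blast
  qed
  then have "card G \<le> 2 * card (f ` G)"
    by (intro card_le_mult_card_image finG)
  also have "f ` G \<subseteq> (H <#>\<^bsub>SL2\<^esub> H) \<times> (H <#>\<^bsub>SL2\<^esub> H)"
    using A(1) by (force simp: f_def G_def set_mult_def SL2_def)
  then have "f ` G \<subseteq> (H <#>\<^bsub>SL2\<^esub> H <#>\<^bsub>SL2\<^esub> H) \<times> (H <#>\<^bsub>SL2\<^esub> H <#>\<^bsub>SL2\<^esub> H)"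
    using Sigma_mono[OF HHH HHH] by (rule order_trans)
  then have "card (f ` G) \<le> card (H <#>\<^bsub>SL2\<^esub> H <#>\<^bsub>SL2\<^esub> H) ^ 2"
    using fin3 card_mono[OF finite_cartesian_product[OF fin3 fin3]]
    by (simp add: card_cartesian_product power2_eq_square)
  finally have G: "real (card G) \<le> 2 * T ^ 2"
    unfolding T_def by (simp flip: of_nat_power of_nat_mult)
  \<comment> \<open>Inversion as a function, so that the triples with \<open>x y = 1\<close> or
    \<open>x z = 1\<close> are images of \<open>A \<times> A\<close>.\<close>
  define I where "I x = (SOME y. x ** y = mat 1)" for x :: "'k ^ 2 ^ 2"
  have I: "I x = y" if "x \<in> A" "x ** y = mat 1" for x y
  proof -
    have "x ** I x = mat 1" unfolding I_def using that(2) by (rule someI)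
    with that show ?thesis using SL2_mult_cancel(1)[OF det] by metis
  qed
  have pairs: "real (card (g ` (A \<times> A))) \<le> N ^ 2"
    for g :: "_ \<Rightarrow> ('k ^ 2 ^ 2) \<times> ('k ^ 2 ^ 2) \<times> ('k ^ 2 ^ 2)"
    using card_image_le[of "A \<times> A" g] finA unfolding N_def
    by (simp add: card_cartesian_product power2_eq_square flip: of_nat_mult)
  let ?B1 = "(\<lambda>(x, z). (x, I x, z)) ` (A \<times> A)"
  let ?B2 = "(\<lambda>(x, y). (x, y, I x)) ` (A \<times> A)"
  let ?B3 = "(\<lambda>(x, y). (x, y, y)) ` (A \<times> A)"
  let ?B4 = "SIGMA x:A. E x \<times> E x"
  have "A \<times> A \<times> A \<subseteq> ?B1 \<union> ?B2 \<union> ?B3 \<union> ?B4 \<union> G"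
  proof
    fix w assume "w \<in> A \<times> A \<times> A"
    then obtain x y z where w: "w = (x, y, z)" and xyz: "x \<in> A" "y \<in> A" "z \<in> A" by auto
    consider "x ** y = mat 1" | "x ** z = mat 1" | "y = z" | "common_eigvec {x, y, z}" | "w \<in> G"
      using w xyz unfolding G_def by blast
    then show "w \<in> ?B1 \<union> ?B2 \<union> ?B3 \<union> ?B4 \<union> G"
    proof cases
      case 1
      then have "w \<in> ?B1" using w xyz I[of x y] by force
      then show ?thesis by blast
    next
      case 2
      then have "w \<in> ?B2" using w xyz I[of x z] by force
      then show ?thesis by blast
    next
      case 3
      then have "w \<in> ?B3" using w xyz by force
      then show ?thesis by blast
    next
      case 4
      \<comment> \<open>Forgetting that the two eigenvectors coincide makes the choices of
        \<open>y\<close> and \<open>z\<close> independent.\<close>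
      then have "common_eigvec {x, y}" "common_eigvec {x, z}" by (auto simp: common_eigvec_def)
      then have "w \<in> ?B4" using w xyz by (simp add: E_def)
      then show ?thesis by blast
    qed blast
  qed
  then have "card (A \<times> A \<times> A) \<le> card (?B1 \<union> ?B2 \<union> ?B3 \<union> ?B4 \<union> G)"
    using finA finG by (intro card_mono) (auto simp: E_def)
  also have "\<dots> \<le> card ?B1 + card ?B2 + card ?B3 + card ?B4 + card G"
    by (intro order_trans[OF card_Un_le] add_mono order_refl)
  finally have "real (card (A \<times> A \<times> A))
      \<le> real (card ?B1) + real (card ?B2) + real (card ?B3) + real (card ?B4) + real (card G)"
    by (simp flip: of_nat_add)
  moreover have "real (card ?B1) \<le> N ^ 2" "real (card ?B2) \<le> N ^ 2" "real (card ?B3) \<le> N ^ 2"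
    by (rule pairs)+
  moreover have "real (card ?B4) \<le> 16 * T * N"
  proof -
    have "finite (E x)" for x using finA by (simp add: E_def)
    then have "real (card ?B4) = (\<Sum>x\<in>A. real (card (E x \<times> E x)))"
      using finA by simp
    also have "\<dots> \<le> real (card A) * (16 * T)" using E by (rule sum_bounded_above)
    finally show ?thesis by (simp add: N_def algebra_simps)
  qed
  moreover have "real (card (A \<times> A \<times> A)) = N ^ 3"
    by (simp add: N_def card_cartesian_product power3_eq_cube)
  ultimately show ?thesis using G by linarith
qed

text \<open>If \<open>n > 7 T^(2/3)\<close>, the three terms on the right are at most
  \<open>3/7\<close>, \<open>16/49\<close> and \<open>2/343\<close> of \<open>n^3\<close>, and these
  fractions sum to \<open>261/343 < 1\<close>.\<close>

lemma cubic_inequality_bound: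
  fixes n T :: real
  assumes "T \<ge> 1" and ineq: "n ^ 3 \<le> 3 * n ^ 2 + 16 * T * n + 2 * T ^ 2"
  shows "n \<le> 7 * T powr (2/3)"
proof (rule ccontr)
  assume n: "\<not> ?thesis"
  define u where "u = T powr (1/3)"
  have u1: "u \<ge> 1" using assms(1) by (simp add: u_def ge_one_powr_ge_zero)
  have T: "T = u ^ 3" using assms(1) by (simp add: u_def powr_power)
  have "T powr (2/3) = u ^ 2" using assms(1) by (simp add: u_def powr_power)
  with n have n: "n > 7 * u ^ 2" by simp
  have "u ^ 2 \<ge> 1" using u1 by simp
  with n have n7: "n > 7" by simp
  have "u ^ 3 \<le> (u ^ 2) ^ 2" using u1 power_increasing[of 3 4 u] by simp
  moreover have "(7 * u ^ 2) ^ 2 \<le> n ^ 2" using n by (intro power_mono) auto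
  ultimately have "49 * T \<le> n ^ 2" by (simp add: T power_mult_distrib)
  then have "49 * T * n \<le> n ^ 2 * n" using n7 by (intro mult_right_mono) auto
  then have "16 * T * n \<le> 16 / 49 * n ^ 3" by (simp add: power2_eq_square power3_eq_cube)
  moreover have "3 * n ^ 2 \<le> 3 / 7 * n ^ 3" using n7 by (simp add: power2_eq_square power3_eq_cube)
  moreover have "343 * T ^ 2 \<le> n ^ 3"
  proof -
    have "(7 * u ^ 2) ^ 3 \<le> n ^ 3" using n by (intro power_mono) auto
    then show ?thesis by (simp add: T power_mult_distrib flip: power_mult)
  qed
  moreover have "n ^ 3 > 0" using n7 by simp
  ultimately show False using ineq by linarith
qed

section \<open>From generators and conjugacy classes to the counting bound\<close>

lemma generating_set_no_invariant_line:
  fixes H :: "('k::field ^ 2 ^ 2) set"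
  assumes gen: "generate SL2 H = carrier SL2" and inv: "set_inv\<^bsub>SL2\<^esub> H = H" and v: "v \<noteq> 0"
  shows "\<exists>h\<in>H. \<nexists>c. h *v v = c *s v"
proof (rule ccontr)
  assume "\<not> ?thesis"
  then have H: "\<exists>c. h *v v = c *s v" if "h \<in> H" for h using that by blast
  have all: "\<exists>c. h *v v = c *s v" if "h \<in> generate SL2 H" for h
    using that
  proof induction
    case one
    then show ?case by (auto simp: SL2_def intro: exI[of _ 1])
  next
    case (incl h)
    then show ?case by (rule H)
  next
    case (inv h)
    \<comment> \<open>The symmetry of \<open>H\<close> turns inverses of generators into
      generators.\<close>
    then have "inv\<^bsub>SL2\<^esub> h \<in> H" using assms(2) by (auto simp: SET_INV_def)
    then show ?case by (rule H)
  next
    case (eng h1 h2)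
    then show ?case
      by (auto simp: SL2_def vector_scalar_commute simp flip: matrix_vector_mul_assoc)
  qed
  \<comment> \<open>The only eigenlines of these two unipotents are the two coordinate axes, one
    each.\<close>
  let ?U = "vector [vector [1, 1], vector [0, 1]] :: 'k ^ 2 ^ 2"
  let ?L = "vector [vector [1, 0], vector [1, 1]] :: 'k ^ 2 ^ 2"
  have "?U \<in> generate SL2 H" "?L \<in> generate SL2 H"
    unfolding gen by (simp_all add: SL2_def det_2)
  then obtain c d where "?U *v v = c *s v" "?L *v v = d *s v" using all by blast
  then have "v $ 1 + v $ 2 = c * v $ 1" "v $ 2 = c * v $ 2" "v $ 1 = d * v $ 1" "v $ 1 + v $ 2 = d * v $ 2"
    by (simp_all add: mat2_simps)
  then have "v $ 1 = 0 \<and> v $ 2 = 0" by (metis add_cancel_left_right add_cancel_right_right mult_cancel_right2 mult_zero_right)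
  with v show False by (simp add: vec_eq_iff forall_2)
qed

text \<open>The conjugacy class enters the count only through these two facts; the second holds
  because scalars are central.\<close>

lemma conj_class_SL2_invariants:
  fixes g :: "'k::field ^ 2 ^ 2"
  assumes "h \<in> conj_class SL2 g"
  shows "trace h = trace g"
    and "h = mat c \<Longrightarrow> g = mat c"
proof -
  interpret group "SL2 :: ('k ^ 2 ^ 2) monoid" by (rule group_SL2)
  obtain x where x: "x \<in> carrier SL2" "h = x ** g ** inv\<^bsub>SL2\<^esub> x"
    using assms by (auto simp: conj_class_def SL2_def)
  define y where "y = inv\<^bsub>SL2\<^esub> x"
  have yx: "y ** x = mat 1" using l_inv[OF x(1)] by (simp add: SL2_def y_def)
  have h: "h = x ** (g ** y)" using x(2) by (simp add: y_def matrix_mul_assoc)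
  have "trace h = trace (g ** y ** x)" unfolding h by (rule trace_mul_sym)
  also have "\<dots> = trace g" by (simp add: yx flip: matrix_mul_assoc)
  finally show "trace h = trace g" .
  have comm: "mat c ** A = A ** mat c" for A :: "'k ^ 2 ^ 2"
    by (simp add: mat2_simps mult.commute)
  assume "h = mat c"
  have "g = y ** x ** g ** (y ** x)" by (simp add: yx)
  also have "\<dots> = y ** h ** x" by (simp add: h matrix_mul_assoc)
  also have "\<dots> = mat c" using \<open>h = mat c\<close> by (simp add: yx flip: comm matrix_mul_assoc)
  finally show "g = mat c" .
qed

lemma regular_semisimple_not_scalar:
  fixes g :: "'k::alg_closed_field ^ 2 ^ 2"
  assumes "regular_semisimple g"
  shows "g \<noteq> mat c"
proof
  assume g: "g = mat c"
  have "d = c" if "v \<noteq> 0" "mat c *v v = d *s v" for d and v :: "'k ^ 2"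
    using that by (auto simp: mat_vector_mult vec_eq_iff)
  then have "{d. eigval g d} \<subseteq> {c}" by (auto simp: eigval_def g)
  then have "card {d. eigval g d} \<le> 1" using card_mono[of "{c}"] by simp
  with assms show False by (simp add: regular_semisimple_def)
qed

theorem theorem3p11:
  fixes p :: nat
    and g :: "'p::prime_card mod_ring ^ 2 ^ 2"
    and H :: "('p mod_ring ^ 2 ^ 2) set"
    and \<alpha> :: real
  assumes "CARD('p) = p" and "prime p" and "p \<ge> 3"
    and "g \<in> carrier SL2"
    and "regular_semisimple (to_ac_mat g)"
    and "trace g \<noteq> 0"
    and "H \<subseteq> carrier SL2"
    and "set_inv\<^bsub>SL2\<^esub> H = H"
    and "generate SL2 H = carrier SL2"
    and "\<one>\<^bsub>SL2\<^esub> \<in> H"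
    and "\<alpha> = real (card (H <#>\<^bsub>SL2\<^esub> H <#>\<^bsub>SL2\<^esub> H)) / real (card H)"
    and "\<not> \<alpha> > real (card H) powr (1/28)"
  shows "real (card (conj_class SL2 (to_ac_mat g) \<inter> to_ac_mat ` H))
           \<le> 7 * \<alpha> powr (2/3) * real (card H) powr (2/3)"
proof -
  \<comment> \<open>The class lives over the algebraic closure; pulling it back to \<open>H\<close>
    lets the whole count run over the prime field.\<close>
  define A where "A = {h \<in> H. to_ac_mat h \<in> conj_class SL2 (to_ac_mat g)}"
  define T where "T = real (card (H <#>\<^bsub>SL2\<^esub> H <#>\<^bsub>SL2\<^esub> H))"
  have finH: "finite H" by simp
  have trace_ac: "trace (to_ac_mat h) = to_ac (trace h)" for h :: "'p mod_ring ^ 2 ^ 2"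
    by (simp add: trace_def sum_2)
  have "real (card A) ^ 3 \<le> 3 * real (card A) ^ 2 + 16 * T * real (card A) + 2 * T ^ 2"
    unfolding T_def
  proof (rule card_trace_set_cubed_le[OF finH assms(7,10)])
    show "\<exists>h\<in>H. \<nexists>c. h *v v = c *s v" if "v \<noteq> 0" for v
      using generating_set_no_invariant_line[OF assms(9,8) that] .
    show "A \<subseteq> H" by (auto simp: A_def)
    show "trace h = trace g" if "h \<in> A" for h
    proof -
      have "trace (to_ac_mat h) = trace (to_ac_mat g)"
        using that conj_class_SL2_invariants(1) by (auto simp: A_def)
      then show ?thesis by (simp add: trace_ac)
    qed
    show "h \<noteq> mat c" if "h \<in> A" for h c
    proof
      assume "h = mat c"
      then have "to_ac_mat h = mat (to_ac c)" by (simp add: mat2_simps)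
      with that have "to_ac_mat g = mat (to_ac c)"
        using conj_class_SL2_invariants(2) by (auto simp: A_def)
      with regular_semisimple_not_scalar[OF assms(5)] show False by blast
    qed
  qed (rule assms(6))
  moreover have "T \<ge> 1"
  proof -
    have "H <#>\<^bsub>SL2\<^esub> H <#>\<^bsub>SL2\<^esub> H \<noteq> {}" using assms(10) by (auto simp: set_mult_def)
    then have "card (H <#>\<^bsub>SL2\<^esub> H <#>\<^bsub>SL2\<^esub> H) > 0" using finite card_gt_0_iff by blast
    then show ?thesis by (simp add: T_def)
  qed
  ultimately have bound: "real (card A) \<le> 7 * T powr (2/3)"
    by (intro cubic_inequality_bound)
  have "H \<noteq> {}" using assms(10) by blast
  \<comment> \<open>Since \<open>H\<close> is nonempty, \<open>T\<close> factors as
    \<open>\<alpha> |H|\<close>, and its power splits accordingly.\<close>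
  then have "\<alpha> * real (card H) = T" "\<alpha> \<ge> 0" using finH by (simp_all add: assms(11) T_def)
  then have T: "T powr (2/3) = \<alpha> powr (2/3) * real (card H) powr (2/3)"
    by (simp flip: powr_mult)
  have "conj_class SL2 (to_ac_mat g) \<inter> to_ac_mat ` H = to_ac_mat ` A" by (auto simp: A_def)
  then have "card (conj_class SL2 (to_ac_mat g) \<inter> to_ac_mat ` H) \<le> card A"
    using card_image_le[of A to_ac_mat] by simp
  with bound T show ?thesis by simp
qed

end
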